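(* Let $(z^n,x)\mapsto(\underline{\Pi}_x^n,\overline{\Pi}_x^n)$ be a probabilistic predictor, and define $$\underline{\gamma}_n(A)=\inf_{(z^n,x)\in\mathbb{Z}^n\times\mathbb{X}}\underline{\Pi}_x^n(A),\qquad \overline{\gamma}_n(A)=\sup_{(z^n,x)\in\mathbb{Z}^n\times\mathbb{X}}\overline{\Pi}_x^n(A).$$ Suppose that the probabilistic predictor suffers from one-sided contraction in the sense that, for some $n\ge1$ and some $A\in\mathcal{A}$, $$\underline{\gamma}_n(A)>\inf_{\mathsf{P}\in\mathscr{P}}\mathsf{P}(Y_{n+1}\in A)\quad\text{or}\quad\overline{\gamma}_n(A)<\sup_{\mathsf{P}\in\mathscr{P}}\mathsf{P}(Y_{n+1}\in A).$$ Then the probabilistic predictor is not valid.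
   Context: Data. $Z_1,Z_2,\ldots$ is an exchangeable process, $Z_i=(X_i,Y_i)\in\mathbb{Z}=\mathbb{X}\times\mathbb{Y}$, with $\mathbb{X}\subseteq\mathbb{R}^d$ and $\mathbb{Y}\subseteq\mathbb{R}$. Its joint distribution $\mathsf{P}$ is unknown, belonging to a model $\mathscr{P}$, a set of exchangeable distributions. Write $Z^n=(Z_1,\ldots,Z_n)$. $\mathcal{A}$ is a $\sigma$-algebra of (measurable) subsets of $\mathbb{Y}$ containing all singletons. Probabilistic predictor. For each $n\ge1$, a map $(z^n,x)\mapsto(\underline{\Pi}_x^n,\overline{\Pi}_x^n)$ on $\mathbb{Z}^n\times\mathbb{X}$ (dependence on $z^n$ is indicated only by the superscript $n$), where $\overline{\Pi}_x^n:\mathcal{A}\to[0,1]$ is monotone, takes value $0$ at $\varnothing$ and $1$ at $\mathbb{Y}$, and is sub-additive ($\overline{\Pi}_x^n(A\cup A')\le\overline{\Pi}_x^n(A)+\overline{\Pi}_x^n(A')$ for disjoint $A,A'$), and $\underline{\Pi}_x^n(A)=1-\overline{\Pi}_x^n(A^c)$. The map $(Z^n,X_{n+1})\mapsto(\underline{\Pi}_{X_{n+1}}^n(A),\overline{\Pi}_{X_{n+1}}^n(A))$ is assumed measurable for each $n$ and $A\in\mathcal{A}$. Validity. The probabilistic predictor is valid if $$\sup_{\mathsf{P}\in\mathscr{P}}\mathsf{P}\{\overline{\Pi}_{X_{n+1}}^n(A)\le\alpha,\ Y_{n+1}\in A\}\le\alpha\quad\text{for all }\alpha\in[0,1],\ n\ge1,\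 A\in\mathcal{A};$$ equivalently (by duality), $\sup_{\mathsf{P}\in\mathscr{P}}\mathsf{P}\{\underline{\Pi}_{X_{n+1}}^n(A)\ge1-\alpha,\ Y_{n+1}\notin A\}\le\alpha$ for all $\alpha\in[0,1]$, $n\ge1$, $A\in\mathcal{A}$. *)

theory Defs
  imports "HOL-Probability.Probability" "HOL-Combinatorics.Permutations"
begin

text \<open>
  Observations \<open>z = (x, y)\<close> take values in \<open>X \<times> Y\<close>, where \<open>X\<close> and \<open>Y\<close> carry their relative Borel
  \<open>\<sigma>\<close>-algebras.  The sequence \<open>Z\<^sub>1, Z\<^sub>2, \<dots>\<close> is indexed by the positive naturals, and the sample
  \<open>Z\<^sup>n = (Z\<^sub>1, \<dots>, Z\<^sub>n)\<close> is the restriction of the sequence to \<open>{1..n}\<close>.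
\<close>

definition sample_space :: "'z::topological_space set \<Rightarrow> nat \<Rightarrow> (nat \<Rightarrow> 'z) measure" where
  "sample_space S n = (\<Pi>\<^sub>M i\<in>{1..n}. restrict_space borel S)"

definition process_space :: "'z::topological_space set \<Rightarrow> (nat \<Rightarrow> 'z) measure" where
  "process_space S = (\<Pi>\<^sub>M i\<in>{1..}. restrict_space borel S)"

definition exchangeable :: "'z::topological_space set \<Rightarrow> (nat \<Rightarrow> 'z) measure \<Rightarrow> bool" where
  "exchangeable S P \<longleftrightarrow>
     prob_space P \<and> sets P = sets (process_space S) \<and>
     (\<forall>n \<pi>. \<pi> permutes {1..n} \<longrightarrow>
        distr P (sample_space S n) (\<lambda>\<omega>. \<lambda>i\<in>{1..n}. \<omega> (\<pi> i)) =
        distr P (sample_space S n) (\<lambda>\<omega>. \<lambda>i\<in>{1..n}. \<omega> i))"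

definition event_algebra :: "real set \<Rightarrow> real set set \<Rightarrow> bool" where
  "event_algebra Y \<A> \<longleftrightarrow>
     sigma_algebra Y \<A> \<and> \<A> \<subseteq> sets (restrict_space borel Y) \<and> (\<forall>y\<in>Y. {y} \<in> \<A>)"

definition upper_prob :: "real set \<Rightarrow> real set set \<Rightarrow> (real set \<Rightarrow> real) \<Rightarrow> bool" where
  "upper_prob Y \<A> U \<longleftrightarrow>
     (\<forall>A\<in>\<A>. U A \<in> {0..1}) \<and>
     U {} = 0 \<and> U Y = 1 \<and>
     (\<forall>A\<in>\<A>. \<forall>B\<in>\<A>. A \<subseteq> B \<longrightarrow> U A \<le> U B) \<and>
     (\<forall>A\<in>\<A>. \<forall>B\<in>\<A>. A \<inter> B = {} \<longrightarrow> U (A \<union> B) \<le> U A + U B)"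

text \<open>
  \<open>L n z x A\<close> and \<open>U n z x A\<close> are the lower and upper predictive probabilities of \<open>A\<close> given the sample
  \<open>z = z\<^sup>n\<close> and the new covariate value \<open>x\<close>.
\<close>

type_synonym 'x predictor = "nat \<Rightarrow> (nat \<Rightarrow> 'x \<times> real) \<Rightarrow> 'x \<Rightarrow> real set \<Rightarrow> real"

definition inputs :: "'x set \<Rightarrow> real set \<Rightarrow> nat \<Rightarrow> ((nat \<Rightarrow> 'x \<times> real) \<times> 'x) set" where
  "inputs X Y n = ({1..n} \<rightarrow>\<^sub>E X \<times> Y) \<times> X"

definition probabilistic_predictor ::
    "(real^'d) set \<Rightarrow> real set \<Rightarrow> real set set \<Rightarrow>
     (real^'d) predictor \<Rightarrow> (real^'d) predictor \<Rightarrow> bool" where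
  "probabilistic_predictor X Y \<A> L U \<longleftrightarrow>
     (\<forall>n\<ge>1.
        (\<forall>(z, x) \<in> inputs X Y n.
           upper_prob Y \<A> (U n z x) \<and> (\<forall>A\<in>\<A>. L n z x A = 1 - U n z x (Y - A))) \<and>
        (\<forall>A\<in>\<A>. (\<lambda>(z, x). (L n z x A, U n z x A)) \<in>
           borel_measurable (sample_space (X \<times> Y) n \<Otimes>\<^sub>M restrict_space borel X)))"

text \<open>
  By the duality between \<open>L\<close> and \<open>U\<close>, it suffices to state validity for the upper probability.
\<close>

definition valid ::
    "(nat \<Rightarrow> 'x \<times> real) measure set \<Rightarrow> real set set \<Rightarrow> 'x predictor \<Rightarrow> bool" where
  "valid \<P> \<A> U \<longleftrightarrow>
     (\<forall>\<alpha>\<in>{0..1}. \<forall>n\<ge>1. \<forall>A\<in>\<A>.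
        (SUP P\<in>\<P>. measure P {\<omega> \<in> space P.
            U n (restrict \<omega> {1..n}) (fst (\<omega> (n + 1))) A \<le> \<alpha> \<and> snd (\<omega> (n + 1)) \<in> A}) \<le> \<alpha>)"

definition lower_gamma ::
    "'x set \<Rightarrow> real set \<Rightarrow> 'x predictor \<Rightarrow> nat \<Rightarrow> real set \<Rightarrow> real" where
  "lower_gamma X Y L n A = (INF (z, x) \<in> inputs X Y n. L n z x A)"

definition upper_gamma ::
    "'x set \<Rightarrow> real set \<Rightarrow> 'x predictor \<Rightarrow> nat \<Rightarrow> real set \<Rightarrow> real" where
  "upper_gamma X Y U n A = (SUP (z, x) \<in> inputs X Y n. U n z x A)"

definition prob_next ::
    "(nat \<Rightarrow> 'x \<times> real) measure \<Rightarrow> nat \<Rightarrow> real set \<Rightarrow> real" where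
  "prob_next P n A = measure P {\<omega> \<in> space P. snd (\<omega> (n + 1)) \<in> A}"

definition one_sided_contraction ::
    "'x set \<Rightarrow> real set \<Rightarrow> real set set \<Rightarrow> (nat \<Rightarrow> 'x \<times> real) measure set \<Rightarrow>
     'x predictor \<Rightarrow> 'x predictor \<Rightarrow> bool" where
  "one_sided_contraction X Y \<A> \<P> L U \<longleftrightarrow>
     (\<exists>n\<ge>1. \<exists>A\<in>\<A>.
        lower_gamma X Y L n A > (INF P\<in>\<P>. prob_next P n A) \<or>
        upper_gamma X Y U n A < (SUP P\<in>\<P>. prob_next P n A))"

end

theory Submission
  imports Defs
begin

text \<open>
  At level \<open>\<alpha> = upper_gamma X Y U n A\<close> the constraint \<open>U \<le> \<alpha>\<close> in the validity condition holds surely,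
  so validity bounds the probability of \<open>A\<close> by \<open>\<alpha>\<close> under every model.  Applying this to \<open>A\<close>
  and to \<open>Y - A\<close> excludes the two kinds of contraction.
\<close>

lemma space_exchangeable:
  assumes "exchangeable S P"
  shows "space P = {1..} \<rightarrow>\<^sub>E S"
proof -
  have "space P = space (process_space S)"
    by (rule sets_eq_imp_space_eq) (use assms in \<open>simp add: exchangeable_def\<close>)
  then show ?thesis
    by (simp add: process_space_def space_PiM space_restrict_space)
qed

text \<open>Every path supplies an admissible input, so bounds over \<open>inputs X Y n\<close> hold
  at every outcome and not merely almost surely.\<close>

lemma input_in_inputs:
  assumes "\<omega> \<in> {1..} \<rightarrow>\<^sub>E X \<times> Y"
  shows "(restrict \<omega> {1..n}, fst (\<omega> (n + 1))) \<in> inputs X Y n"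
proof -
  have "\<omega> i \<in> X \<times> Y" if "i \<ge> 1" for i
    using that by (intro PiE_mem[OF assms]) auto
  from this[of "n + 1"] this show ?thesis
    by (auto simp: inputs_def mem_Times_iff)
qed

text \<open>A probability space has at least one outcome, and its path supplies an input. This keeps
  the real-valued supremum and infimum over \<open>inputs X Y n\<close> from being taken over the
  empty set, where their values would be arbitrary.\<close>

lemma inputs_nonempty:
  assumes "exchangeable (X \<times> Y) P"
  shows "inputs X Y n \<noteq> {}"
proof -
  have "space P \<noteq> {}"
    by (rule prob_space.not_empty) (use assms in \<open>simp add: exchangeable_def\<close>)
  then obtain \<omega> where "\<omega> \<in> space P"
    by blast
  then have "\<omega> \<in> {1..} \<rightarrow>\<^sub>E X \<times> Y"
    unfolding space_exchangeable[OF assms] .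
  from input_in_inputs[OF this] show ?thesis by blast
qed

lemma predictor_properties:
  assumes "probabilistic_predictor X Y \<A> L U" "n \<ge> 1" "(z, x) \<in> inputs X Y n"
  shows "upper_prob Y \<A> (U n z x)"
    and "A \<in> \<A> \<Longrightarrow> L n z x A = 1 - U n z x (Y - A)"
proof -
  have "\<forall>(z, x) \<in> inputs X Y n.
      upper_prob Y \<A> (U n z x) \<and> (\<forall>A\<in>\<A>. L n z x A = 1 - U n z x (Y - A))"
    using assms(1,2) unfolding probabilistic_predictor_def by blast
  from bspec[OF this assms(3)]
  show "upper_prob Y \<A> (U n z x)" and "A \<in> \<A> \<Longrightarrow> L n z x A = 1 - U n z x (Y - A)"
    by simp_all
qed

lemma predictor_upper_bounds:
  assumes "probabilistic_predictor X Y \<A> L U" "n \<ge> 1" "(z, x) \<in> inputs X Y n" "A \<in> \<A>"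
  shows "0 \<le> U n z x A" "U n z x A \<le> 1"
  using predictor_properties(1)[OF assms(1-3)] assms(4) by (auto simp: upper_prob_def)

lemma predictor_le_upper_gamma:
  assumes "probabilistic_predictor X Y \<A> L U" "n \<ge> 1" "(z, x) \<in> inputs X Y n" "A \<in> \<A>"
  shows "U n z x A \<le> upper_gamma X Y U n A"
proof -
  have "bdd_above ((\<lambda>(z, x). U n z x A) ` inputs X Y n)"
    using predictor_upper_bounds(2)[OF assms(1,2) _ assms(4)] by (intro bdd_aboveI2[where M = 1]) auto
  from cSUP_upper[OF assms(3) this] show ?thesis
    by (simp add: upper_gamma_def)
qed

text \<open>Makes \<open>upper_gamma X Y U n A\<close> an admissible level \<alpha> in the
  definition of \<open>valid\<close>.\<close>

lemma upper_gamma_bounds: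
  assumes "probabilistic_predictor X Y \<A> L U" "n \<ge> 1" "A \<in> \<A>" "inputs X Y n \<noteq> {}"
  shows "upper_gamma X Y U n A \<in> {0..1}"
proof -
  obtain z x where zx: "(z, x) \<in> inputs X Y n"
    using assms(4) by auto
  have "0 \<le> upper_gamma X Y U n A"
    using predictor_upper_bounds(1)[OF assms(1,2) zx assms(3)]
      predictor_le_upper_gamma[OF assms(1,2) zx assms(3)] by linarith
  moreover have "upper_gamma X Y U n A \<le> 1"
    unfolding upper_gamma_def
    using assms(4) predictor_upper_bounds(2)[OF assms(1,2) _ assms(3)] by (intro cSUP_least) auto
  ultimately show ?thesis by simp
qed

text \<open>By duality \<open>U\<close> at \<open>Y - A\<close> is 1 minus \<open>L\<close> at
  \<open>A\<close> for each input, and \<open>L\<close> never falls below its infimum. This turns a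
  statement about the lower contraction into one about the upper.\<close>

lemma upper_gamma_compl_le:
  assumes "probabilistic_predictor X Y \<A> L U" "n \<ge> 1" "A \<in> \<A>" "Y - A \<in> \<A>" "inputs X Y n \<noteq> {}"
  shows "upper_gamma X Y U n (Y - A) \<le> 1 - lower_gamma X Y L n A"
proof -
  have dual: "L n z x A = 1 - U n z x (Y - A)" if "(z, x) \<in> inputs X Y n" for z x
    using predictor_properties(2)[OF assms(1,2) that assms(3)] .
  have "bdd_below ((\<lambda>(z, x). L n z x A) ` inputs X Y n)"
    using dual predictor_upper_bounds(2)[OF assms(1,2) _ assms(4)]
    by (intro bdd_belowI2[where m = 0]) auto
  then have "lower_gamma X Y L n A \<le> L n z x A" if "(z, x) \<in> inputs X Y n" for z x
    using cINF_lower[OF _ that, of "\<lambda>(z, x). L n z x A"] by (simp add: lower_gamma_def)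
  then show ?thesis
    unfolding upper_gamma_def using assms(5) dual by (intro cSUP_least) force+
qed

lemma valid_prob_next_le:
  assumes ex: "\<forall>P\<in>\<P>. exchangeable (X \<times> Y) P"
    and pred: "probabilistic_predictor X Y \<A> L U"
    and valid: "valid \<P> \<A> U"
    and P: "P \<in> \<P>" and n: "n \<ge> 1" and A: "A \<in> \<A>"
  shows "prob_next P n A \<le> upper_gamma X Y U n A"
proof -
  let ?\<gamma> = "upper_gamma X Y U n A"
  let ?m = "\<lambda>P. measure P {\<omega> \<in> space P.
    U n (restrict \<omega> {1..n}) (fst (\<omega> (n + 1))) A \<le> ?\<gamma> \<and> snd (\<omega> (n + 1)) \<in> A}"
  have exP: "exchangeable (X \<times> Y) P" using ex P by blast
  \<comment> \<open>The bound holds at every outcome, so the event in the validity condition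
    coincides with the event that \<open>A\<close> occurs.\<close>
  have "U n (restrict \<omega> {1..n}) (fst (\<omega> (n + 1))) A \<le> ?\<gamma>" if "\<omega> \<in> space P" for \<omega>
    using that space_exchangeable[OF exP]
    by (intro predictor_le_upper_gamma[OF pred n _ A] input_in_inputs) auto
  then have "prob_next P n A = ?m P"
    unfolding prob_next_def by (intro arg_cong[where f = "measure P"]) auto
  also have "\<dots> \<le> (SUP P\<in>\<P>. ?m P)"
  proof (rule cSUP_upper[OF P])
    \<comment> \<open>A supremum of reals dominates its terms only if they are bounded above;
      probabilities are bounded by 1.\<close>
    have "?m Q \<le> 1" if "Q \<in> \<P>" for Q
      using ex that by (auto simp: exchangeable_def intro: prob_space.prob_le_1)
    then show "bdd_above (?m ` \<P>)" by (intro bdd_aboveI2)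
  qed
  also have "\<dots> \<le> ?\<gamma>"
    using valid upper_gamma_bounds[OF pred n A inputs_nonempty[OF exP]] n A
    unfolding valid_def by blast
  finally show ?thesis .
qed

text \<open>The complement rule requires the event to be measurable, hence the hypothesis that
  \<open>A\<close> is relatively Borel in \<open>Y\<close>.\<close>

lemma prob_next_compl:
  assumes ex: "exchangeable (X \<times> Y) P" and A: "A \<in> sets (restrict_space borel Y)"
  shows "prob_next P n (Y - A) = 1 - prob_next P n A"
proof -
  interpret prob_space P using ex by (simp add: exchangeable_def)
  \<comment> \<open>Observations carry the relative Borel \<sigma>-algebra of the product topology,
    so continuity of the projection gives its measurability.\<close>
  have snd: "snd \<in> restrict_space borel (X \<times> Y) \<rightarrow>\<^sub>M restrict_space borel Y"
    by (intro measurable_restrict_space3 borel_measurable_continuous_onI continuous_intros) auto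
  have "(\<lambda>\<omega>. \<omega> (n + 1)) \<in> process_space (X \<times> Y) \<rightarrow>\<^sub>M restrict_space borel (X \<times> Y)"
    unfolding process_space_def by (rule measurable_component_singleton) simp
  from measurable_compose[OF this snd]
  have "(\<lambda>\<omega>. snd (\<omega> (n + 1))) \<in> process_space (X \<times> Y) \<rightarrow>\<^sub>M restrict_space borel Y" .
  moreover have "sets P = sets (process_space (X \<times> Y))"
    using ex by (simp add: exchangeable_def)
  ultimately have "(\<lambda>\<omega>. snd (\<omega> (n + 1))) \<in> P \<rightarrow>\<^sub>M restrict_space borel Y"
    using measurable_cong_sets[OF _ refl] by blast
  from measurable_sets[OF this A] have "{\<omega> \<in> space P. snd (\<omega> (n + 1)) \<in> A} \<in> events"
    by (simp add: vimage_def Int_def conj_commute)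
  note compl = prob_compl[OF this]
  \<comment> \<open>The response lies in \<open>Y\<close> at every outcome, so missing
    \<open>A\<close> is the same as hitting \<open>Y - A\<close>.\<close>
  have "\<omega> (n + 1) \<in> X \<times> Y" if "\<omega> \<in> space P" for \<omega>
    using that space_exchangeable[OF ex] by (intro PiE_mem[of \<omega> "{1..}"]) auto
  then have "{\<omega> \<in> space P. snd (\<omega> (n + 1)) \<in> Y - A}
      = space P - {\<omega> \<in> space P. snd (\<omega> (n + 1)) \<in> A}"
    by (auto simp: mem_Times_iff)
  with compl show ?thesis by (simp add: prob_next_def)
qed

theorem proposition1:
  fixes X :: "(real^'d) set" and Y :: "real set" and \<A> :: "real set set"
    and \<P> :: "(nat \<Rightarrow> (real^'d) \<times> real) measure set"
    and L U :: "(real^'d) predictor"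
  assumes "event_algebra Y \<A>"
    and "\<P> \<noteq> {}"
    and "\<forall>P\<in>\<P>. exchangeable (X \<times> Y) P"
    and "probabilistic_predictor X Y \<A> L U"
    and "one_sided_contraction X Y \<A> \<P> L U"
  shows "\<not> valid \<P> \<A> U"
proof
  assume "valid \<P> \<A> U"
  note le_gamma = valid_prob_next_le[OF assms(3,4) this]
  obtain n A where n: "n \<ge> 1" and A: "A \<in> \<A>"
    and contraction: "lower_gamma X Y L n A > (INF P\<in>\<P>. prob_next P n A) \<or>
      upper_gamma X Y U n A < (SUP P\<in>\<P>. prob_next P n A)"
    using assms(5) by (auto simp: one_sided_contraction_def)
  interpret sigma_algebra Y \<A> using assms(1) by (simp add: event_algebra_def)
  have A_borel: "A \<in> sets (restrict_space borel Y)"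
    using assms(1) A by (auto simp: event_algebra_def)
  have compl: "Y - A \<in> \<A>" using A by (rule compl_sets)
  \<comment> \<open>The chain is: lower gamma of \<open>A\<close> \<le> 1 - upper gamma of
    \<open>Y - A\<close> \<le> 1 - P(\<open>Y - A\<close>) = P(\<open>A\<close>), with validity
    applied to \<open>Y - A\<close> in the middle.\<close>
  have "lower_gamma X Y L n A \<le> prob_next P n A" if P: "P \<in> \<P>" for P
  proof -
    have ex: "exchangeable (X \<times> Y) P" using assms(3) P by blast
    show ?thesis
      using le_gamma[OF P n compl] prob_next_compl[OF ex A_borel, of n]
        upper_gamma_compl_le[OF assms(4) n A compl inputs_nonempty[OF ex]] by linarith
  qed
  then have "lower_gamma X Y L n A \<le> (INF P\<in>\<P>. prob_next P n A)"
    using assms(2) by (intro cINF_greatest)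
  moreover have "(SUP P\<in>\<P>. prob_next P n A) \<le> upper_gamma X Y U n A"
    using assms(2) le_gamma[OF _ n A] by (intro cSUP_least)
  ultimately show False using contraction by linarith
qed

end
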